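(* Let $X$ be a hyperelliptic Riemann surface of genus $g\ge 1$ with finite branch points $e_1,\dots,e_{2g+1}$ and $e_{2g+2}=\infty$, and let $T$, $A$, $E$, $\Omega_j$, $a_j$, $b_j$, $R$, $\Delta^a$, $\Delta^b$, $\theta_R$ be as in the context. Choose any $g$ distinct indices $i_1,\dots,i_g\in\{1,\dots,2g+1\}$, and put $$\Omega_\delta=\Omega_{i_1}+\cdots+\Omega_{i_g}=T\Big(\sum_{k=1}^g a_{i_k}\Big)+\sum_{k=1}^g b_{i_k}.$$ Let $\delta$ denote the characteristic of $R+\Omega_\delta$, i.e. $\delta=\begin{bmatrix} \Delta^a+\sum_k a_{i_k} \\ \Delta^b+\sum_k b_{i_k} \end{bmatrix}$, which is a non-singular even characteristic (so $\theta[\delta]$ is an even function and $\theta[\delta](0)\neq 0$). Then, for points $z\ne w$ and $u=A(z-w)\in\mathbb{C}^g$, $$\frac{\theta[\delta](u)}{\theta[\delta](0)\,E(z,w)}=\exp\Big(2\pi i\Big(\sum_{k=1}^g a_{i_k}\Big)\cdot u\Big)\,\frac{\theta_R(u+\Omega_\delta)}{\theta_R(\Omega_\delta)\,E(z,w)} .$$ Consequently, for $N\ge 2$ and points $z_1,\dots,z_N$, with $z_{N+1}=z_1$ and $z_i\neq z_{i+1}$ for all $i$, $$\prod_{i=1}^N S_\delta(z_i,z_{i+1})=\prod_{i=1}^N F_g\big(A(z_i-z_{i+1}),\Omega_\delta\big)=\prod_{i=1}^N\frac{\theta_R\big(A(z_i-z_{i+1})+\Omega_\delta\big)}{\theta_R(\Omega_\delta)\,E(z_i,z_{i+1})},$$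 where $S_\delta(z,w)=\dfrac{\theta[\delta](A(z-w))}{\theta[\delta](0)\,E(z,w)}$ and, for $u=A(z-w)$ and $\alpha\in\mathbb{C}^g$, $F_g(u,\alpha)=\dfrac{\theta_R(u+\alpha)}{\theta_R(\alpha)\,E(z,w)}$.
   Context: Setting. $X$ is the hyperelliptic curve $y^2=\prod_{k=1}^{2g+1}(x-e_k)$ with distinct finite branch points $e_1,\dots,e_{2g+1}$ and $e_{2g+2}=\infty$. Fix a canonical homology basis $A_1,\dots,A_g,B_1,\dots,B_g$ and holomorphic one-forms $\omega_1,\dots,\omega_g$ normalized by $\oint_{A_I}\omega_J=\delta_{IJ}$. The period matrix is $T=(\oint_{B_I}\omega_J)$, which is symmetric with positive definite imaginary part. Theta functions. For $a,b\in\frac12\mathbb{Z}^g$ and $u\in\mathbb{C}^g$, $$\theta\begin{bmatrix} a \\ b \end{bmatrix}(u)=\sum_{n\in\mathbb{Z}^g}\exp\{i\pi (n+a)^tT(n+a)+2\pi i(n+a)\cdot(u+b)\}.$$ The characteristic is even or odd according to whether $4a\cdot b$ is even or odd. An even characteristic $\delta$ is non-singular if $\theta[\delta](0)\ne0$. Abel map and prime form. $A(z-w)=\big(\int_w^z\omega_1,\dots,\int_w^z\omega_g\big)\in\mathbb{C}^g$. Points are taken on the universal cover (or a fixed simply connected fundamental domain) with integration paths chosen consistently, so that $A(z-w)+A(w-v)=A(z-v)$. The prime form is $E(z,w)=\dfrac{\theta[\nu](A(z-w))}{h_\nu(z)h_\nu(w)}$, where $\nu$ is a non-singular odd characteristic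 and $h_\nu^2=\sum_I\partial_I\theta[\nu](0)\,\omega_I$. Half periods. For $j=1,\dots,2g+1$, $\Omega_j=\int_\infty^{e_j}(\omega_1,\dots,\omega_g)=T a_j+b_j\in\mathbb{C}^g$, where $a_j,b_j$ are $g$-vectors with entries in $\{0,\frac12\}$. Set $R=\Omega_2+\Omega_4+\cdots+\Omega_{2g}=T\Delta^a+\Delta^b$ with $\Delta^a=\sum_{i=1}^g a_{2i}$ and $\Delta^b=\sum_{i=1}^g b_{2i}$. The homology basis is the standard one, for which $R$ is the vector of Riemann constants with base point $\infty$; it is known that the characteristic of $R+\Omega_{i_1}+\cdots+\Omega_{i_g}$ is then non-singular and even for every choice of $g$ distinct indices in $\{1,\dots,2g+1\}$. Write $\theta_R(u)=\theta\begin{bmatrix} \Delta^a \\ \Delta^b \end{bmatrix}(u)$. *)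

theory Defs
  imports "HOL-Complex_Analysis.Complex_Analysis"
begin

section \<open>Theta functions with characteristics\<close>

text \<open>The genus is the cardinality of the finite index type \<open>'g\<close>. The dot product is bilinear,
  unlike the (real-valued) inner product of the library on complex vectors.\<close>

definition cdot :: "complex ^ 'g \<Rightarrow> complex ^ 'g \<Rightarrow> complex" where
  "cdot u v = (\<Sum>i\<in>UNIV. u $ i * v $ i)"

definition of_int_vec :: "int ^ 'g \<Rightarrow> complex ^ 'g" where
  "of_int_vec n = (\<chi> i. of_int (n $ i))"

definition theta ::
  "complex ^ 'g ^ 'g \<Rightarrow> complex ^ 'g \<Rightarrow> complex ^ 'g \<Rightarrow> complex ^ 'g::finite \<Rightarrow> complex" where
  "theta T a b u =
     (\<Sum>\<^sub>\<infinity>n::int ^ 'g. exp (\<i> * of_real pi * cdot (of_int_vec n + a) (T *v (of_int_vec n + a))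
                          + 2 * of_real pi * \<i> * cdot (of_int_vec n + a) (u + b)))"

definition half_integral :: "complex ^ 'g::finite \<Rightarrow> bool" where
  "half_integral a \<longleftrightarrow> (\<forall>i. 2 * a $ i \<in> \<int>)"

definition even_characteristic :: "complex ^ 'g::finite \<Rightarrow> complex ^ 'g \<Rightarrow> bool" where
  "even_characteristic a b \<longleftrightarrow> half_integral a \<and> half_integral b
     \<and> (\<exists>k::int. even k \<and> 4 * cdot a b = of_int k)"

definition odd_characteristic :: "complex ^ 'g::finite \<Rightarrow> complex ^ 'g \<Rightarrow> bool" where
  "odd_characteristic a b \<longleftrightarrow> half_integral a \<and> half_integral b
     \<and> (\<exists>k::int. odd k \<and> 4 * cdot a b = of_int k)"

definition theta_grad0 ::
  "complex ^ 'g ^ 'g \<Rightarrow> complex ^ 'g \<Rightarrow> complex ^ 'g::finite \<Rightarrow> complex ^ 'g" where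
  "theta_grad0 T a b = (\<chi> I. deriv (\<lambda>s. theta T a b (axis I s)) 0)"

definition nonsingular_even ::
  "complex ^ 'g ^ 'g \<Rightarrow> complex ^ 'g \<Rightarrow> complex ^ 'g::finite \<Rightarrow> bool" where
  "nonsingular_even T a b \<longleftrightarrow> even_characteristic a b \<and> theta T a b 0 \<noteq> 0"

definition nonsingular_odd ::
  "complex ^ 'g ^ 'g \<Rightarrow> complex ^ 'g \<Rightarrow> complex ^ 'g::finite \<Rightarrow> bool" where
  "nonsingular_odd T a b \<longleftrightarrow> odd_characteristic a b \<and> theta_grad0 T a b \<noteq> 0"


section \<open>The hyperelliptic surface and its universal cover\<close>

text \<open>Since the polynomial has odd degree, the smooth compactification of the affine curve
  adds a single point, so its underlying space is the one-point compactification.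
  \<open>None\<close> is the point at infinity and \<open>Some (e j, 0)\<close> are the finite branch points.\<close>

definition affine_curve :: "nat \<Rightarrow> (nat \<Rightarrow> complex) \<Rightarrow> (complex \<times> complex) set" where
  "affine_curve g e = {(x, y). y ^ 2 = (\<Prod>k = 1..2 * g + 1. x - e k)}"

definition hyperelliptic_surface ::
  "nat \<Rightarrow> (nat \<Rightarrow> complex) \<Rightarrow> (complex \<times> complex) option topology" where
  "hyperelliptic_surface g e = Alexandroff_compactification (top_of_set (affine_curve g e))"

text \<open>The analogue of \<open>covering_space\<close> for abstract topologies.\<close>

definition covering_map :: "'a topology \<Rightarrow> 'b topology \<Rightarrow> ('a \<Rightarrow> 'b) \<Rightarrow> bool" where
  "covering_map C X p \<longleftrightarrow>
     continuous_map C X p \<and> p ` topspace C = topspace X \<and>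
     (\<forall>x\<in>topspace X. \<exists>U. x \<in> U \<and> openin X U \<and>
        (\<exists>\<V>. \<Union>\<V> = {c \<in> topspace C. p c \<in> U} \<and> (\<forall>V\<in>\<V>. openin C V) \<and> pairwise disjnt \<V> \<and>
             (\<forall>V\<in>\<V>. homeomorphic_map (subtopology C V) (subtopology X U) p)))"

text \<open>By uniformization the universal cover of a compact Riemann surface of positive genus
  is a simply connected domain of the complex plane. It is enough to ask for holomorphy of \<open>p\<close>
  over the affine part: the fibre over infinity is discrete and \<open>p\<close> is continuous, so the
  singularities there are removable.\<close>

definition universal_cover ::
  "nat \<Rightarrow> (nat \<Rightarrow> complex) \<Rightarrow> complex set \<Rightarrow> (complex \<Rightarrow> (complex \<times> complex) option) \<Rightarrow> bool" where
  "universal_cover g e D p \<longleftrightarrow>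
     open D \<and> simply_connected D \<and>
     covering_map (top_of_set D) (hyperelliptic_surface g e) p \<and>
     (\<lambda>t. fst (the (p t))) holomorphic_on {t \<in> D. p t \<noteq> None} \<and>
     (\<lambda>t. snd (the (p t))) holomorphic_on {t \<in> D. p t \<noteq> None}"

definition deck_transformation ::
  "complex set \<Rightarrow> (complex \<Rightarrow> 'x) \<Rightarrow> (complex \<Rightarrow> complex) \<Rightarrow> bool" where
  "deck_transformation D p \<sigma> \<longleftrightarrow>
     \<sigma> holomorphic_on D \<and> bij_betw \<sigma> D D \<and> (\<forall>t\<in>D. p (\<sigma> t) = p t)"

text \<open>A holomorphic one-form on the surface, given by its pullback \<open>f(t) dt\<close> to the universal cover:
  a holomorphic one-form on \<open>D\<close> invariant under all deck transformations.\<close>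

definition holomorphic_form ::
  "complex set \<Rightarrow> (complex \<Rightarrow> 'x) \<Rightarrow> (complex \<Rightarrow> complex) \<Rightarrow> bool" where
  "holomorphic_form D p f \<longleftrightarrow> f holomorphic_on D \<and>
     (\<forall>\<sigma>. deck_transformation D p \<sigma> \<longrightarrow> (\<forall>t\<in>D. f (\<sigma> t) * deriv \<sigma> t = f t))"

text \<open>A simple loop on the surface, given by a lift to the universal cover; the lift itself need
  not be closed.\<close>

definition loop_lift :: "complex set \<Rightarrow> (complex \<Rightarrow> 'x) \<Rightarrow> (real \<Rightarrow> complex) \<Rightarrow> bool" where
  "loop_lift D p \<gamma> \<longleftrightarrow> valid_path \<gamma> \<and> path_image \<gamma> \<subseteq> D \<and>
     p (pathfinish \<gamma>) = p (pathstart \<gamma>) \<and> inj_on (p \<circ> \<gamma>) {0..<1}"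

text \<open>The loops meet in one point only, transversally and with intersection number \<open>+1\<close>.
  The lifts are chosen to pass through the same point over the intersection, so that
  the tangent directions can be compared in the plane.\<close>

definition cross_once :: "(complex \<Rightarrow> 'x) \<Rightarrow> (real \<Rightarrow> complex) \<Rightarrow> (real \<Rightarrow> complex) \<Rightarrow> bool" where
  "cross_once p \<alpha> \<beta> \<longleftrightarrow>
     (\<exists>s\<in>{0<..<1}. \<exists>s'\<in>{0<..<1}. \<exists>v w.
        \<alpha> s = \<beta> s' \<and> p ` path_image \<alpha> \<inter> p ` path_image \<beta> = {p (\<alpha> s)} \<and>
        (\<alpha> has_vector_derivative v) (at s) \<and> (\<beta> has_vector_derivative w) (at s') \<and>
        Im (cnj v * w) > 0)"

text \<open>On a surface of genus \<open>CARD('g)\<close>, loops with these intersections automatically form a basis of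
  the first homology group, because the intersection form is unimodular.\<close>

definition canonical_homology_basis ::
  "complex set \<Rightarrow> (complex \<Rightarrow> 'x) \<Rightarrow> ('g::finite \<Rightarrow> real \<Rightarrow> complex) \<Rightarrow> ('g \<Rightarrow> real \<Rightarrow> complex) \<Rightarrow> bool"
where
  "canonical_homology_basis D p \<alpha> \<beta> \<longleftrightarrow>
     (\<forall>I. loop_lift D p (\<alpha> I) \<and> loop_lift D p (\<beta> I) \<and> cross_once p (\<alpha> I) (\<beta> I)) \<and>
     (\<forall>I J. I \<noteq> J \<longrightarrow>
        p ` path_image (\<alpha> I) \<inter> p ` path_image (\<alpha> J) = {} \<and>
        p ` path_image (\<beta> I) \<inter> p ` path_image (\<beta> J) = {} \<and>
        p ` path_image (\<alpha> I) \<inter> p ` path_image (\<beta> J) = {})"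


section \<open>Periods, Abel map, prime form\<close>

definition period_matrix ::
  "('g::finite \<Rightarrow> real \<Rightarrow> complex) \<Rightarrow> ('g \<Rightarrow> complex \<Rightarrow> complex) \<Rightarrow> complex ^ 'g ^ 'g" where
  "period_matrix \<beta> \<omega> = (\<chi> I J. contour_integral (\<beta> I) (\<omega> J))"

definition pos_def_imag :: "complex ^ 'g ^ 'g::finite \<Rightarrow> bool" where
  "pos_def_imag T \<longleftrightarrow>
     (\<forall>v::real ^ 'g. v \<noteq> 0 \<longrightarrow> 0 < (\<Sum>i\<in>UNIV. \<Sum>j\<in>UNIV. v $ i * Im (T $ i $ j) * v $ j))"

text \<open>\<open>abel_map D \<omega> z w\<close> is \<open>A(z - w)\<close>. As \<open>D\<close> is simply connected, the choice of the path
  does not matter.\<close>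

definition abel_map ::
  "complex set \<Rightarrow> ('g::finite \<Rightarrow> complex \<Rightarrow> complex) \<Rightarrow> complex \<Rightarrow> complex \<Rightarrow> complex ^ 'g" where
  "abel_map D \<omega> z w = (\<chi> J. contour_integral
     (SOME \<gamma>. valid_path \<gamma> \<and> path_image \<gamma> \<subseteq> D \<and> pathstart \<gamma> = w \<and> pathfinish \<gamma> = z) (\<omega> J))"

text \<open>The root \<open>h\<close> is a coefficient with respect to \<open>dt\<close> on the universal cover.\<close>

definition form_root ::
  "complex set \<Rightarrow> ('g::finite \<Rightarrow> complex \<Rightarrow> complex) \<Rightarrow> complex ^ 'g ^ 'g \<Rightarrow>
   complex ^ 'g \<Rightarrow> complex ^ 'g \<Rightarrow> (complex \<Rightarrow> complex) \<Rightarrow> bool" where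
  "form_root D \<omega> T na nb h \<longleftrightarrow> h holomorphic_on D \<and>
     (\<forall>t\<in>D. h t ^ 2 = (\<Sum>I\<in>UNIV. theta_grad0 T na nb $ I * \<omega> I t))"

text \<open>The quotient defining the prime form has removable singularities at the zeros of \<open>h\<close>;
  the limit fills them in (division by zero would give 0) and agrees with the quotient elsewhere.\<close>

definition prime_form ::
  "complex set \<Rightarrow> (complex \<Rightarrow> complex \<Rightarrow> complex ^ 'g) \<Rightarrow> complex ^ 'g ^ 'g \<Rightarrow>
   complex ^ 'g \<Rightarrow> complex ^ 'g::finite \<Rightarrow> (complex \<Rightarrow> complex) \<Rightarrow> complex \<Rightarrow> complex \<Rightarrow> complex" where
  "prime_form D A T na nb h z w =
     Lim (at (z, w) within {(z', w'). z' \<in> D \<and> w' \<in> D \<and> h z' \<noteq> 0 \<and> h w' \<noteq> 0})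
       (\<lambda>(z', w'). theta T na nb (A z' w') / (h z' * h w'))"

text \<open>\<open>K\<close> is the vector of Riemann constants with base point \<open>q\<close>, i.e. the vector, unique modulo
  the period lattice, which translates the locus of sums of \<open>g - 1\<close> points to the theta divisor.\<close>

definition riemann_constants ::
  "complex set \<Rightarrow> (complex \<Rightarrow> complex \<Rightarrow> complex ^ 'g) \<Rightarrow> complex ^ 'g ^ 'g \<Rightarrow> complex \<Rightarrow>
   complex ^ 'g::finite \<Rightarrow> bool" where
  "riemann_constants D A T q K \<longleftrightarrow>
     (\<forall>\<zeta>. theta T 0 0 \<zeta> = 0 \<longleftrightarrow>
        (\<exists>(t::nat \<Rightarrow> complex) m n. (\<forall>k\<in>{1..<CARD('g)}. t k \<in> D) \<and>
            \<zeta> = K + (\<Sum>k = 1..<CARD('g). A (t k) q) + (T *v of_int_vec m + of_int_vec n)))"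


section \<open>The kernels\<close>

definition szego ::
  "(complex \<Rightarrow> complex \<Rightarrow> complex ^ 'g) \<Rightarrow> (complex \<Rightarrow> complex \<Rightarrow> complex) \<Rightarrow> complex ^ 'g ^ 'g \<Rightarrow>
   complex ^ 'g \<Rightarrow> complex ^ 'g::finite \<Rightarrow> complex \<Rightarrow> complex \<Rightarrow> complex" where
  "szego A E T da db z w = theta T da db (A z w) / (theta T da db 0 * E z w)"

text \<open>In \<open>F_g(u, \<alpha>)\<close> with \<open>u = A(z - w)\<close> the prime form depends on \<open>z\<close> and \<open>w\<close>, which therefore
  are the arguments here; \<open>Ra\<close>, \<open>Rb\<close> is the characteristic of \<open>\<theta>\<^sub>R\<close>.\<close>

definition F_kernel ::
  "(complex \<Rightarrow> complex \<Rightarrow> complex ^ 'g) \<Rightarrow> (complex \<Rightarrow> complex \<Rightarrow> complex) \<Rightarrow> complex ^ 'g ^ 'g \<Rightarrow>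
   complex ^ 'g \<Rightarrow> complex ^ 'g::finite \<Rightarrow> complex \<Rightarrow> complex \<Rightarrow> complex ^ 'g \<Rightarrow> complex" where
  "F_kernel A E T Ra Rb z w \<alpha> = theta T Ra Rb (A z w + \<alpha>) / (theta T Ra Rb \<alpha> * E z w)"

end

theory Submission
  imports Defs
begin

text \<open>Completing the square in the theta series gives
  \<open>\<theta>[a + s, b + t](u) = C exp(2 \<pi> i s \<cdot> u) \<theta>[a, b](u + T s + t)\<close> with a constant \<open>C \<noteq> 0\<close>, which cancels
  after division by the value at \<open>u = 0\<close>. On the simply connected domain \<open>D\<close> the forms have
  primitives, so the exponents \<open>s \<cdot> A(z\<^sub>k - z\<^sub>k\<^sub>+\<^sub>1)\<close> telescope to zero around a cycle.\<close>

lemma cdot_add_left: "cdot (u + v) w = cdot u w + cdot v w"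
  by (simp add: cdot_def distrib_right sum.distrib)

lemma cdot_add_right: "cdot u (v + w) = cdot u v + cdot u w"
  by (simp add: cdot_def distrib_left sum.distrib)

lemma cdot_minus_left: "cdot (- u) v = - cdot u v"
  by (simp add: cdot_def sum_negf)

lemma cdot_minus_right: "cdot u (- v) = - cdot u v"
  by (simp add: cdot_def sum_negf)

lemma cdot_diff_right: "cdot u (v - w) = cdot u v - cdot u w"
  by (simp add: cdot_def right_diff_distrib sum_subtractf)

lemma cdot_zero_right [simp]: "cdot u 0 = 0"
  by (simp add: cdot_def)

lemma cdot_sum_right: "cdot u (\<Sum>k\<in>S. f k) = (\<Sum>k\<in>S. cdot u (f k))"
  by (induction S rule: infinite_finite_induct) (simp_all add: cdot_add_right)

text \<open>Makes the two cross terms of the quadratic form in \<open>theta\<close> equal, so that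
  together they form a single linear term.\<close>

lemma cdot_symmetric_matrix:
  fixes T :: "complex ^ 'g ^ 'g::finite"
  assumes "transpose T = T"
  shows "cdot u (T *v v) = cdot v (T *v u)"
proof -
  have "T $ i $ j = T $ j $ i" for i j
    using arg_cong[OF assms, of "\<lambda>M. M $ j $ i"] by (simp add: transpose_def)
  then have "cdot v (T *v u) = (\<Sum>i\<in>UNIV. \<Sum>j\<in>UNIV. v $ i * (T $ j $ i * u $ j))"
    by (simp add: cdot_def matrix_vector_mult_def sum_distrib_left)
  also have "\<dots> = cdot u (T *v v)"
    by (subst sum.swap) (simp add: cdot_def matrix_vector_mult_def sum_distrib_left mult_ac)
  finally show ?thesis ..
qed

lemma theta_shift_characteristic:
  fixes T :: "complex ^ 'g ^ 'g::finite"
  assumes "transpose T = T"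
  shows "theta T (a + s) (b + t) u =
    exp (\<i> * of_real pi * cdot s (T *v s) + 2 * of_real pi * \<i> * cdot s (b + t))
      * exp (2 * of_real pi * \<i> * cdot s u) * theta T a b (u + (T *v s + t))"
  \<comment> \<open>Moving the constant under the sum allows a comparison for each fixed
    \<open>n\<close>. No reindexing takes place, so \<open>s\<close> and \<open>t\<close> may be
    arbitrary complex vectors.\<close>
  unfolding theta_def infsum_cmult_right' [symmetric]
proof (rule infsum_cong)
  fix n :: "int ^ 'g"
  define m where "m = of_int_vec n + a"
  have split: "of_int_vec n + (a + s) = m + s"
    by (simp add: m_def add.assoc)
  \<comment> \<open>The cross terms add up to 2 pi i m . (T s), which is the effect of translating
    the argument by T s; what remains does not involve \<open>n\<close>.\<close>
  have "cdot s (T *v m) = cdot m (T *v s)"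
    by (rule cdot_symmetric_matrix [OF assms])
  then show "exp (\<i> * of_real pi * cdot (of_int_vec n + (a + s)) (T *v (of_int_vec n + (a + s)))
        + 2 * of_real pi * \<i> * cdot (of_int_vec n + (a + s)) (u + (b + t))) =
      exp (\<i> * of_real pi * cdot s (T *v s) + 2 * of_real pi * \<i> * cdot s (b + t))
        * exp (2 * of_real pi * \<i> * cdot s u) *
      exp (\<i> * of_real pi * cdot (of_int_vec n + a) (T *v (of_int_vec n + a))
        + 2 * of_real pi * \<i> * cdot (of_int_vec n + a) (u + (T *v s + t) + b))"
    unfolding split m_def [symmetric] exp_add [symmetric]
    by (simp add: cdot_add_left cdot_add_right matrix_vector_right_distrib algebra_simps)
qed

text \<open>At u = 0 the exponential linear in \<open>u\<close> is 1, and the remaining constant is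
  an exponential, hence nonzero, and cancels. The factor \<open>c\<close> will be the prime
  form.\<close>

lemma theta_ratio_shift_characteristic:
  assumes "transpose T = T"
  shows "theta T (a + s) (b + t) u / (theta T (a + s) (b + t) 0 * c) =
    exp (2 * of_real pi * \<i> * cdot s u)
      * (theta T a b (u + (T *v s + t)) / (theta T a b (T *v s + t) * c))"
  unfolding theta_shift_characteristic [OF assms] by simp

text \<open>The reflection of n + a to -(n + a) is a bijection of the shifted lattice because 2a is
  integral. It fixes the quadratic part of the exponent and changes the linear part only by a
  multiple of 2 pi i.\<close>

lemma theta_even:
  fixes T :: "complex ^ 'g ^ 'g::finite"
  assumes "even_characteristic a b"
  shows "theta T a b (- u) = theta T a b u"
proof -
  have "\<forall>i. \<exists>k. 2 * a $ i = of_int k"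
    using assms by (auto simp: even_characteristic_def half_integral_def Ints_def)
  then obtain a2 where a2: "2 * a $ i = of_int (a2 i)" for i by metis
  have "\<forall>i. \<exists>k. 2 * b $ i = of_int k"
    using assms by (auto simp: even_characteristic_def half_integral_def Ints_def)
  then obtain b2 where b2: "2 * b $ i = of_int (b2 i)" for i by metis
  \<comment> \<open>This is where evenness enters: 2 a . b is the integer \<open>k\<close>.\<close>
  obtain k where k: "4 * cdot a b = of_int (2 * k)"
    using assms by (auto simp: even_characteristic_def elim: evenE)
  define f :: "int ^ 'g \<Rightarrow> int ^ 'g" where "f n = (\<chi> i. - (n $ i) - a2 i)" for n
  have f_involution: "f (f n) = n" for n
    by (simp add: f_def vec_eq_iff)
  have f_bij: "bij f"
    by (rule o_bij [of f]) (simp_all add: fun_eq_iff f_involution)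
  have f_shift: "of_int_vec (f n) + a = - (of_int_vec n + a)" for n
    by (simp add: f_def of_int_vec_def vec_eq_iff a2 [symmetric])
  \<comment> \<open>The number 2 (n + a) . b is an integer: 2 n . b is one because 2b is integral,
    and 2 a . b is \<open>k\<close>.\<close>
  have period: "exp (2 * of_real pi * \<i> * (2 * cdot (of_int_vec n + a) b)) = 1" for n
  proof -
    have "2 * cdot (of_int_vec n) b = (\<Sum>i\<in>UNIV. of_int (n $ i) * (2 * b $ i))"
      by (simp add: cdot_def of_int_vec_def sum_distrib_left mult_ac)
    also have "\<dots> = of_int (\<Sum>i\<in>UNIV. n $ i * b2 i)"
      by (simp add: b2)
    finally have "2 * cdot (of_int_vec n + a) b = of_int ((\<Sum>i\<in>UNIV. n $ i * b2 i) + k)"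
      using k by (simp add: cdot_add_left)
    then have "2 * of_real pi * \<i> * (2 * cdot (of_int_vec n + a) b)
        = \<i> * (of_int ((\<Sum>i\<in>UNIV. n $ i * b2 i) + k) * (of_real pi * 2))"
      by (simp only: mult_ac)
    then show ?thesis
      by (simp only: exp_2pi_1_int)
  qed
  let ?term = "\<lambda>u n. exp (\<i> * of_real pi * cdot (of_int_vec n + a) (T *v (of_int_vec n + a))
                          + 2 * of_real pi * \<i> * cdot (of_int_vec n + a) (u + b))"
  have "?term (- u) (f n) = ?term u n" for n
  proof -
    define x where "x = of_int_vec n + a"
    have "T *v (- x) = - (T *v x)"
      using matrix_vector_mult_diff_distrib [of T 0 x] by simp
    then have "?term u n
        = ?term (- u) (f n) * exp (2 * of_real pi * \<i> * (2 * cdot x b))"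
      unfolding f_shift x_def [symmetric] exp_add [symmetric]
      by (simp add: cdot_minus_left cdot_minus_right cdot_add_right cdot_diff_right algebra_simps)
    then show ?thesis
      using period [of n] by (simp add: x_def)
  qed
  then show ?thesis
    unfolding theta_def
    using infsum_reindex_bij_betw [OF f_bij, of "?term (- u)"] by simp
qed

text \<open>Frees the Abel map from the path picked by \<open>SOME\<close>: each form has a global
  primitive on \<open>D\<close>, so only the endpoints matter and A(z - w) becomes additive along
  chains of points.\<close>

lemma abel_map_primitive:
  fixes \<omega> :: "'g::finite \<Rightarrow> complex \<Rightarrow> complex"
  assumes "open D" "simply_connected D" "\<And>J. \<omega> J holomorphic_on D"
  obtains G :: "complex \<Rightarrow> complex ^ 'g"
  where "\<And>z w. z \<in> D \<Longrightarrow> w \<in> D \<Longrightarrow> abel_map D \<omega> z w = G z - G w"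
proof -
  have "\<forall>J. \<exists>g. \<forall>t\<in>D. (g has_field_derivative \<omega> J t) (at t)"
    using simply_connected_eq_global_primitive [OF assms(1)] assms(2,3) by blast
  then obtain g where g: "\<And>J t. t \<in> D \<Longrightarrow> (g J has_field_derivative \<omega> J t) (at t)"
    by metis
  show thesis
  proof
    fix z w
    assume zw: "z \<in> D" "w \<in> D"
    define \<gamma> where
      "\<gamma> = (SOME \<gamma>. valid_path \<gamma> \<and> path_image \<gamma> \<subseteq> D \<and> pathstart \<gamma> = w \<and> pathfinish \<gamma> = z)"
    \<comment> \<open>A connected open set joins any two points by a polynomial path, so
      \<open>SOME\<close> really yields a path from \<open>w\<close> to \<open>z\<close> in
      \<open>D\<close>.\<close>
    have "connected D"
      by (rule simply_connected_imp_connected [OF assms(2)])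
    then have "\<exists>\<gamma>. valid_path \<gamma> \<and> path_image \<gamma> \<subseteq> D \<and> pathstart \<gamma> = w \<and> pathfinish \<gamma> = z"
      using connected_open_polynomial_connected [OF assms(1) _ zw(2,1)]
        valid_path_polynomial_function by metis
    then have "valid_path \<gamma> \<and> path_image \<gamma> \<subseteq> D \<and> pathstart \<gamma> = w \<and> pathfinish \<gamma> = z"
      unfolding \<gamma>_def by (rule someI_ex)
    then have "contour_integral \<gamma> (\<omega> J) = g J z - g J w" for J
      using contour_integral_primitive [of D "g J" "\<omega> J" \<gamma>] g
      by (metis contour_integral_unique has_field_derivative_at_within)
    \<comment> \<open>This instantiates \<open>G\<close> as the vector of the primitives
      \<open>g J\<close>.\<close>
    then show "abel_map D \<omega> z w = (\<chi> J. g J z) - (\<chi> J. g J w)"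
      by (simp add: abel_map_def \<gamma>_def vec_eq_iff)
  qed
qed

theorem proposition1:
  fixes e :: "nat \<Rightarrow> complex"
    and D :: "complex set"
    and p :: "complex \<Rightarrow> (complex \<times> complex) option"
    and \<alpha> \<beta> :: "'g::finite \<Rightarrow> real \<Rightarrow> complex"
    and \<omega> :: "'g \<Rightarrow> complex \<Rightarrow> complex"
    and T :: "complex ^ 'g ^ 'g"
    and A :: "complex \<Rightarrow> complex \<Rightarrow> complex ^ 'g"
    and na nb :: "complex ^ 'g"
    and h :: "complex \<Rightarrow> complex"
    and E :: "complex \<Rightarrow> complex \<Rightarrow> complex"
    and q :: complex
    and r :: "nat \<Rightarrow> complex"
    and \<Omega> a b :: "nat \<Rightarrow> complex ^ 'g"
    and R \<Delta>a \<Delta>b :: "complex ^ 'g"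
    and i :: "nat \<Rightarrow> nat"
    and \<Omega>\<delta> \<delta>a \<delta>b :: "complex ^ 'g"
  assumes branch_points: "inj_on e {1..2 * CARD('g) + 1}"
    and cover: "universal_cover CARD('g) e D p"
    and basis: "canonical_homology_basis D p \<alpha> \<beta>"
    and forms: "\<And>J. holomorphic_form D p (\<omega> J)"
    and normalized: "\<And>I J. contour_integral (\<alpha> I) (\<omega> J) = (if I = J then 1 else 0)"
    and T_eq: "T = period_matrix \<beta> \<omega>"
    and T_symmetric: "transpose T = T"
    and T_pos_def: "pos_def_imag T"
    and A_eq: "A = abel_map D \<omega>"
    and nu: "nonsingular_odd T na nb"
    and h: "form_root D \<omega> T na nb h"
    and E_eq: "E = prime_form D A T na nb h"
    and infinity: "q \<in> D" "p q = None"
    and ramification: "\<And>j. j \<in> {1..2 * CARD('g) + 1} \<Longrightarrow> r j \<in> D \<and> p (r j) = Some (e j, 0)"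
    and \<Omega>_eq: "\<And>j. \<Omega> j = A (r j) q"
    and half_periods: "\<And>j. j \<in> {1..2 * CARD('g) + 1} \<Longrightarrow>
          (\<forall>I. a j $ I \<in> {0, 1/2} \<and> b j $ I \<in> {0, 1/2}) \<and> \<Omega> j = T *v a j + b j"
    and R_eq: "R = (\<Sum>k = 1..CARD('g). \<Omega> (2 * k))"
    and \<Delta>a_eq: "\<Delta>a = (\<Sum>k = 1..CARD('g). a (2 * k))"
    and \<Delta>b_eq: "\<Delta>b = (\<Sum>k = 1..CARD('g). b (2 * k))"
    and standard_basis: "riemann_constants D A T q R"
    and known_nonsingular: "\<And>S. S \<subseteq> {1..2 * CARD('g) + 1} \<Longrightarrow> card S = CARD('g) \<Longrightarrow>
          nonsingular_even T (\<Delta>a + (\<Sum>j\<in>S. a j)) (\<Delta>b + (\<Sum>j\<in>S. b j))"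
    and indices: "inj_on i {1..CARD('g)}" "i ` {1..CARD('g)} \<subseteq> {1..2 * CARD('g) + 1}"
    and \<Omega>\<delta>_eq: "\<Omega>\<delta> = (\<Sum>k = 1..CARD('g). \<Omega> (i k))"
    and \<delta>a_eq: "\<delta>a = \<Delta>a + (\<Sum>k = 1..CARD('g). a (i k))"
    and \<delta>b_eq: "\<delta>b = \<Delta>b + (\<Sum>k = 1..CARD('g). b (i k))"
  shows "\<Omega>\<delta> = T *v (\<Sum>k = 1..CARD('g). a (i k)) + (\<Sum>k = 1..CARD('g). b (i k))
    \<and> nonsingular_even T \<delta>a \<delta>b
    \<and> (\<forall>u. theta T \<delta>a \<delta>b (- u) = theta T \<delta>a \<delta>b u)
    \<and> (\<forall>z\<in>D. \<forall>w\<in>D. p z \<noteq> p w \<longrightarrow>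
         theta T \<delta>a \<delta>b (A z w) / (theta T \<delta>a \<delta>b 0 * E z w)
         = exp (2 * of_real pi * \<i> * cdot (\<Sum>k = 1..CARD('g). a (i k)) (A z w))
           * (theta T \<Delta>a \<Delta>b (A z w + \<Omega>\<delta>) / (theta T \<Delta>a \<Delta>b \<Omega>\<delta> * E z w)))
    \<and> (\<forall>(N::nat) (z::nat \<Rightarrow> complex).
         2 \<le> N \<longrightarrow> (\<forall>k\<in>{1..N}. z k \<in> D) \<longrightarrow> z (N + 1) = z 1 \<longrightarrow>
         (\<forall>k\<in>{1..N}. p (z k) \<noteq> p (z (k + 1))) \<longrightarrow>
         (\<Prod>k = 1..N. szego A E T \<delta>a \<delta>b (z k) (z (k + 1)))
           = (\<Prod>k = 1..N. F_kernel A E T \<Delta>a \<Delta>b (z k) (z (k + 1)) \<Omega>\<delta>)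
         \<and> (\<Prod>k = 1..N. F_kernel A E T \<Delta>a \<Delta>b (z k) (z (k + 1)) \<Omega>\<delta>)
           = (\<Prod>k = 1..N. theta T \<Delta>a \<Delta>b (A (z k) (z (k + 1)) + \<Omega>\<delta>)
                          / (theta T \<Delta>a \<Delta>b \<Omega>\<delta> * E (z k) (z (k + 1)))))"
proof -
  let ?s = "\<Sum>k = 1..CARD('g). a (i k)" and ?t = "\<Sum>k = 1..CARD('g). b (i k)"
  have Om: "\<Omega>\<delta> = T *v ?s + ?t"
  proof -
    have "\<Omega> (i k) = T *v a (i k) + b (i k)" if "k \<in> {1..CARD('g)}" for k
      using half_periods [of "i k"] indices(2) that by blast
    then have "\<Omega>\<delta> = (\<Sum>k = 1..CARD('g). T *v a (i k) + b (i k))"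
      unfolding \<Omega>\<delta>_eq by (rule sum.cong [OF refl])
    then show ?thesis
      by (simp add: sum.distrib linear_sum [OF matrix_vector_mul_linear])
  qed
  \<comment> \<open>Injectivity of \<open>i\<close> gives the index set exactly g elements and turns
    sums over it into sums over \<open>k\<close>.\<close>
  have ns: "nonsingular_even T \<delta>a \<delta>b"
    using known_nonsingular [OF indices(2)] indices(1)
    by (simp add: card_image sum.reindex \<delta>a_eq \<delta>b_eq)
  then have even: "\<forall>u. theta T \<delta>a \<delta>b (- u) = theta T \<delta>a \<delta>b u"
    by (simp add: nonsingular_even_def theta_even)
  have kernel: "theta T \<delta>a \<delta>b u / (theta T \<delta>a \<delta>b 0 * c)
      = exp (2 * of_real pi * \<i> * cdot ?s u)
        * (theta T \<Delta>a \<Delta>b (u + \<Omega>\<delta>) / (theta T \<Delta>a \<Delta>b \<Omega>\<delta> * c))" for u c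
    unfolding \<delta>a_eq \<delta>b_eq Om by (rule theta_ratio_shift_characteristic [OF T_symmetric])
  obtain G where G: "\<And>z w. z \<in> D \<Longrightarrow> w \<in> D \<Longrightarrow> A z w = G z - G w"
    using abel_map_primitive [of D \<omega>] cover forms
    unfolding A_eq universal_cover_def holomorphic_form_def by metis
  have cycle: "(\<Prod>k = 1..N. szego A E T \<delta>a \<delta>b (z k) (z (k + 1)))
      = (\<Prod>k = 1..N. F_kernel A E T \<Delta>a \<Delta>b (z k) (z (k + 1)) \<Omega>\<delta>)"
    if "2 \<le> N" and "\<forall>k\<in>{1..N}. z k \<in> D" and "z (N + 1) = z 1" for N and z :: "nat \<Rightarrow> complex"
  proof -
    \<comment> \<open>The last point z (N + 1) is covered only through the closing condition, as it
      equals z 1.\<close>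
    have "z (k + 1) \<in> D" if "k \<in> {1..N}" for k
      using \<open>\<forall>k\<in>{1..N}. z k \<in> D\<close> \<open>z (N + 1) = z 1\<close> that by (cases "k = N") auto
    then have "(\<Sum>k = 1..N. A (z k) (z (k + 1))) = (\<Sum>k = 1..N. G (z k) - G (z (k + 1)))"
      using that(2) by (intro sum.cong) (auto simp: G)
    \<comment> \<open>The sum collapses to G (z 1) - G (z (N + 1)).\<close>
    also have "\<dots> = 0"
      using sum_natinterval_diff [of "\<lambda>k. G (z k)" 1 N] that by simp
    finally have "(\<Prod>k = 1..N. exp (2 * of_real pi * \<i> * cdot ?s (A (z k) (z (k + 1))))) = 1"
      by (simp add: exp_sum [symmetric] sum_distrib_left [symmetric] cdot_sum_right [symmetric])
    \<comment> \<open>By \<open>kernel\<close>, the two products differ exactly by the product of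
      exponentials just shown to be 1.\<close>
    then show ?thesis
      unfolding szego_def F_kernel_def kernel prod.distrib by simp
  qed
  show ?thesis
    using Om ns even kernel cycle by (auto simp: F_kernel_def)
qed

end
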